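(* Let $d\ge1$ and let $\{M_i\}_{i\ge1}$ be a sequence of elements of a subgroup of $GL_d(\mathbb{C})$ that is conjugate (in $GL_d(\mathbb{C})$) to the unitary group. Let $\{D_i\}_{i\ge1}$ be a sequence in $GL_d(\mathbb{C})$ with $\sum_{i\ge1}\|D_i-M_i\|<\infty$, and let $\varepsilon_n=\sum_{i>n}\|D_i-M_i\|$. Then $$F:=\lim_{n\to\infty}\left(\prod_{i=1}^n D_i\right)\left(\prod_{i=1}^n M_i\right)^{-1}$$ exists, and $F$ is invertible if and only if $D_i$ is invertible for all $i\ge1$. Also, as $n\to\infty$, $$\left\|F-\left(\prod_{i=1}^n D_i\right)\left(\prod_{i=1}^n M_i\right)^{-1}\right\|=O(\varepsilon_n),\qquad \left\|\prod_{i=1}^n D_i-F\prod_{i=1}^n M_i\right\|=O(\varepsilon_n),$$ and in particular $\prod_{i=1}^n D_i\asymp F\prod_{i=1}^n M_i$. More generally, let $f$ be a continuous function from the domain $$\overline{\left\{F\prod_{i=1}^n M_i:n\ge h\right\}}\cup\bigcup_{n\ge h}\left\{\prod_{i=1}^n D_i\right\},$$ for some integer $h\ge1$, into a metric space $G$. Then the domain of $f$ is compact and $f\left(\prod_{i=1}^n D_i\right)\asymp f\left(F\prod_{i=1}^n M_i\right)$. Finally, $$\copyright\left(\prod_{i=1}^n D_i\right)=\copyright\left(F\prod_{i=1}^n M_i\right)\quad\text{and}\quad \copyright\left(f\left(\prod_{i=1}^n D_i\right)\right)=\copyright\left(f\left(F\prod_{i=1}^n M_i\right)\right).$$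
   Context: $\mathfrak{M}_d(\mathbb{C})$ is the algebra of $d\times d$ complex matrices with a fixed norm $\|\cdot\|$ (all norms being equivalent). Products are taken from left to right: $\prod_{i=1}^n A_i=A_1A_2\cdots A_n$. $\overline{S}$ denotes the closure of $S$. For sequences in a metric space $(X,d)$, $s_n\asymp t_n$ means $\lim_{n\to\infty}d(s_n,t_n)=0$. The sequential closure $\copyright(s_n)$ of a sequence is the set of limits of its convergent subsequences. *)

theory Defs
  imports "HOL-Analysis.Analysis" "HOL-Library.Landau_Symbols" "HOL-Algebra.Group"
begin

text \<open>
  The algebra of \<open>d \<times> d\<close> complex matrices is \<^typ>\<open>complex ^ 'd ^ 'd\<close> with the matrix
  product \<open>(**)\<close>; the type-class multiplication on this type is componentwise and is
  not used, whence the explicit recursion for ordered products below.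
\<close>

definition matrix_norm :: "(complex ^ 'd ^ 'd \<Rightarrow> real) \<Rightarrow> bool" where
  "matrix_norm N \<longleftrightarrow>
     (\<forall>A. 0 \<le> N A) \<and>
     (\<forall>A. N A = 0 \<longleftrightarrow> A = 0) \<and>
     (\<forall>A B. N (A + B) \<le> N A + N B) \<and>
     (\<forall>c A. N (\<chi> i j. c * A $ i $ j) = cmod c * N A)"

definition general_linear :: "(complex ^ 'd ^ 'd) monoid" where
  "general_linear = \<lparr>carrier = {A. invertible A}, mult = (**), one = mat 1\<rparr>"

definition conj_transpose :: "complex ^ 'd ^ 'd \<Rightarrow> complex ^ 'd ^ 'd" where
  "conj_transpose A = (\<chi> i j. cnj (A $ j $ i))"

definition unitary_group :: "(complex ^ 'd ^ 'd) set" where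
  "unitary_group = {U. U ** conj_transpose U = mat 1 \<and> conj_transpose U ** U = mat 1}"

definition conjugate_in_GL :: "(complex ^ 'd ^ 'd) set \<Rightarrow> (complex ^ 'd ^ 'd) set \<Rightarrow> bool" where
  "conjugate_in_GL H K \<longleftrightarrow>
     (\<exists>S. invertible S \<and> H = (\<lambda>U. S ** U ** matrix_inv S) ` K)"

text \<open>\<open>mprod A n\<close> is \<open>A 1 ** A 2 ** \<dots> ** A n\<close>; the entry \<open>A 0\<close> is ignored.\<close>

primrec mprod :: "(nat \<Rightarrow> complex ^ 'd ^ 'd) \<Rightarrow> nat \<Rightarrow> complex ^ 'd ^ 'd" where
  "mprod A 0 = mat 1"
| "mprod A (Suc n) = mprod A n ** A (Suc n)"

text \<open>
  The distance is a parameter, so that the relation can be used both with the metric of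
  an arbitrary matrix norm and with \<^const>\<open>dist\<close>.
\<close>

definition asymp_seq :: "('a \<Rightarrow> 'a \<Rightarrow> real) \<Rightarrow> (nat \<Rightarrow> 'a) \<Rightarrow> (nat \<Rightarrow> 'a) \<Rightarrow> bool" where
  "asymp_seq \<delta> s t \<longleftrightarrow> (\<lambda>n. \<delta> (s n) (t n)) \<longlonglongrightarrow> 0"

definition seq_closure :: "(nat \<Rightarrow> 'a::topological_space) \<Rightarrow> 'a set" where
  "seq_closure s = {l. \<exists>r. strict_mono r \<and> (s \<circ> r) \<longlonglongrightarrow> l}"

end

theory Submission
  imports Defs
begin

text \<open>
  Write \<open>P\<^sub>n = M\<^sub>1 \<dots> M\<^sub>n\<close>, \<open>Q\<^sub>n = D\<^sub>1 \<dots> D\<^sub>n\<close> and \<open>G\<^sub>n = Q\<^sub>n P\<^sub>n\<^sup>-\<^sup>1\<close>. The matrices \<open>P\<^sub>n\<close> and their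
  inverses stay in the group \<open>H\<close>, which is bounded, being a conjugate of the unitary group
  (\<open>bounded_conjugate_of_unitary_group\<close>). Replacing one factor \<open>M\<^sub>n\<^sub>+\<^sub>1\<close> by \<open>D\<^sub>n\<^sub>+\<^sub>1\<close> changes
  \<open>G\<^sub>n\<close> by \<open>G\<^sub>n E\<^sub>n\<close>, where \<open>E\<^sub>n = P\<^sub>n (D\<^sub>n\<^sub>+\<^sub>1 - M\<^sub>n\<^sub>+\<^sub>1) P\<^sub>n\<^sub>+\<^sub>1\<^sup>-\<^sup>1\<close>
  (\<open>quotient_mprod_step\<close>). Because both outer factors are bounded, the norms of the \<open>E\<^sub>n\<close> are
  summable; so \<open>G\<^sub>n = (1 + E\<^sub>0) \<dots> (1 + E\<^sub>n\<^sub>-\<^sub>1)\<close> is an absolutely convergent infinite product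
  whose remainder is controlled by the tail of the series
  (\<open>relative_increments_limit\<close>). Multiplying \<open>F - G\<^sub>n\<close> by the bounded \<open>P\<^sub>n\<close> carries
  the rate over to \<open>F P\<^sub>n - Q\<^sub>n\<close>.

  The limit is invertible because \<open>G\<^sub>m\<^sup>-\<^sup>1 F\<close> is the product of the factors from \<open>m\<close> on,
  and hence tends to the identity as \<open>m\<close> grows (\<open>invertible_limit_of_products\<close>).

  What remains is metric topology. All limit points of \<open>Q\<^sub>n\<close> are limit points of the bounded
  sequence \<open>F P\<^sub>n\<close>, which makes the domain of \<open>f\<close> compact
  (\<open>compact_closure_union_asymp\<close>); so \<open>f\<close> is uniformly continuous there and preserves
  the relation \<open>\<asymp>\<close> (\<open>asymp_seq_continuous_image\<close>); and related sequences have the same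
  limits along every subsequence (\<open>seq_closure_eq_asymp\<close>).
\<close>

section \<open>Sequences with summable relative increments\<close>

text \<open>
  A discrete Gronwall estimate: \<open>norm (x n)\<close> grows at most by the factors \<open>1 + \<delta> i \<le> exp (\<delta> i)\<close>
  and is therefore bounded, which makes the increments themselves summable, with tails dominated
  by those of \<open>\<delta>\<close>. The explicit constant matters: it stays bounded when the estimate is applied
  to a sequence started at a late index, where the tails of \<open>\<delta>\<close> become small.
\<close>

lemma relative_increments_limit:
  fixes x :: "nat \<Rightarrow> 'a::banach"
  assumes step: "\<And>n. norm (x (Suc n) - x n) \<le> norm (x n) * \<delta> n"
    and nonneg: "\<And>n. 0 \<le> \<delta> n"
    and summable: "summable \<delta>"
  obtains l where "x \<longlonglongrightarrow> l"
    and "\<And>m. norm (l - x m) \<le> norm (x 0) * exp (suminf \<delta>) * (\<Sum>i. \<delta> (i + m))"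
proof -
  let ?B = "norm (x 0) * exp (suminf \<delta>)"
  have growth: "norm (x n) \<le> norm (x 0) * (\<Prod>i<n. 1 + \<delta> i)" for n
  proof (induction n)
    case (Suc n)
    have "norm (x (Suc n)) \<le> norm (x n) + norm (x (Suc n) - x n)"
      by norm
    also have "\<dots> \<le> norm (x n) * (1 + \<delta> n)"
      using step[of n] by (simp add: algebra_simps)
    also have "\<dots> \<le> norm (x 0) * (\<Prod>i<n. 1 + \<delta> i) * (1 + \<delta> n)"
      by (intro mult_right_mono Suc.IH add_nonneg_nonneg nonneg) simp
    finally show ?case by (simp add: mult_ac)
  qed simp
  have bounded: "norm (x n) \<le> ?B" for n
  proof -
    have "(\<Prod>i<n. 1 + \<delta> i) \<le> exp (\<Sum>i<n. \<delta> i)"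
      by (intro prod_le_exp_sum nonneg)
    also have "\<dots> \<le> exp (suminf \<delta>)"
      using sum_le_suminf[OF summable, of "{..<n}"] nonneg by simp
    finally show ?thesis
      using growth[of n] by (meson mult_left_mono norm_ge_zero order_trans)
  qed
  have increment: "norm (x (Suc n) - x n) \<le> ?B * \<delta> n" for n
    using step[of n] mult_right_mono[OF bounded nonneg] by (rule order_trans)
  have tail_summable: "summable (\<lambda>i. ?B * \<delta> (i + m))" for m
    using summable by (intro summable_mult) simp
  have inc_summable: "summable (\<lambda>i. norm (x (Suc (i + m)) - x (i + m)))" for m
    by (rule summable_comparison_test'[OF tail_summable[of m], of 0]) (use increment in auto)
  have "summable (\<lambda>i. x (Suc i) - x i)"
    using inc_summable[of 0] by (simp add: summable_norm_cancel)
  then have "convergent (\<lambda>n. x n - x 0)"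
    by (simp add: summable_iff_convergent sum_lessThan_telescope)
  then have "convergent x"
    by (simp add: convergent_diff_const_right_iff)
  then obtain l where l: "x \<longlonglongrightarrow> l"
    by (auto simp: convergent_def)
  have "norm (l - x m) \<le> ?B * (\<Sum>i. \<delta> (i + m))" for m
  proof -
    have "(\<lambda>i. x (i + m)) \<longlonglongrightarrow> l"
      using l by (rule LIMSEQ_ignore_initial_segment)
    then have "(\<lambda>i. x (Suc (i + m)) - x (i + m)) sums (l - x m)"
      using telescope_sums[of "\<lambda>i. x (i + m)" l] by simp
    then have "l - x m = (\<Sum>i. x (Suc (i + m)) - x (i + m))"
      by (simp add: sums_iff)
    also have "norm \<dots> \<le> (\<Sum>i. ?B * \<delta> (i + m))"
      by (rule order_trans[OF summable_norm[OF inc_summable]])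
        (rule suminf_le[OF increment inc_summable tail_summable])
    finally show ?thesis
      using summable by (simp add: suminf_mult)
  qed
  with l show thesis by (rule that)
qed

section \<open>Norms of complex matrices\<close>

text \<open>
  The estimates below work with the Euclidean norm of matrices. Bilinearity in finite dimension
  bounds the norm of a product up to a constant, which takes the place of submultiplicativity.
\<close>

lemma bounded_bilinear_complex_matrix_mult:
  "bounded_bilinear ((**) :: complex ^ 'd ^ 'd \<Rightarrow> complex ^ 'd ^ 'd \<Rightarrow> complex ^ 'd ^ 'd)"
proof -
  have "(A + B) ** C = A ** C + B ** C" for A B C :: "complex ^ 'd ^ 'd"
    by (simp add: vec_eq_iff matrix_matrix_mult_def distrib_right sum.distrib)
  moreover have "(r *\<^sub>R A) ** B = r *\<^sub>R (A ** B)" "A ** (r *\<^sub>R B) = r *\<^sub>R (A ** B)"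
    for r and A B :: "complex ^ 'd ^ 'd"
    by (simp_all add: vec_eq_iff matrix_matrix_mult_def scaleR_sum_right)
  ultimately show ?thesis
    unfolding bilinear_conv_bounded_bilinear[symmetric] bilinear_def
    using matrix_add_ldistrib by (blast intro: linearI)
qed

lemma complex_matrix_mult_bound:
  "\<exists>K>0. \<forall>(A :: complex ^ 'd ^ 'd) (B :: complex ^ 'd ^ 'd). norm (A ** B) \<le> norm A * norm B * K"
  by (rule bounded_bilinear.pos_bounded[OF bounded_bilinear_complex_matrix_mult])

lemma tendsto_det:
  fixes X :: "nat \<Rightarrow> complex ^ 'd ^ 'd"
  assumes "X \<longlonglongrightarrow> A"
  shows "(\<lambda>n. det (X n)) \<longlonglongrightarrow> det A"
  unfolding det_def by (intro tendsto_sum tendsto_mult tendsto_const tendsto_prod tendsto_vec_nth assms)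

text \<open>
  A norm is convex, hence continuous on a finite-dimensional space, so it attains a minimum and
  a maximum on the unit sphere; the minimum is positive by definiteness.
\<close>

lemma matrix_norm_equivalent:
  assumes "matrix_norm N"
  obtains a b where "a > 0" "b > 0"
    and "\<And>A. norm A \<le> a * N A" and "\<And>A :: complex ^ 'd ^ 'd. N A \<le> b * norm A"
proof -
  have nonneg: "0 \<le> N A" and zero: "N A = 0 \<longleftrightarrow> A = 0" and tri: "N (A + B) \<le> N A + N B" for A B
    using assms by (auto simp: matrix_norm_def)
  have hom: "N (c *\<^sub>R A) = \<bar>c\<bar> * N A" for c A
  proof -
    have "c *\<^sub>R A = (\<chi> i j. of_real c * A $ i $ j)"
      unfolding vec_eq_iff by (simp add: scaleR_conv_of_real[where 'a = complex])
    moreover have "N (\<chi> i j. of_real c * A $ i $ j) = cmod (of_real c) * N A"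
      using assms unfolding matrix_norm_def by blast
    ultimately show ?thesis by simp
  qed
  have "convex_on UNIV N"
  proof (rule convex_onI)
    fix t :: real and A B :: "complex ^ 'd ^ 'd"
    assume "0 < t" "t < 1"
    then show "N ((1 - t) *\<^sub>R A + t *\<^sub>R B) \<le> (1 - t) * N A + t * N B"
      using tri[of "(1 - t) *\<^sub>R A" "t *\<^sub>R B"] by (simp add: hom)
  qed simp
  then have "continuous_on UNIV N"
    by (rule convex_on_continuous[OF open_UNIV])
  then have cont: "continuous_on (sphere 0 1) N"
    by (rule continuous_on_subset) simp
  have sphere: "compact (sphere (0 :: complex ^ 'd ^ 'd) 1)" "sphere (0 :: complex ^ 'd ^ 'd) 1 \<noteq> {}"
    by auto
  obtain A0 where A0: "norm A0 = 1" and min: "\<And>A. norm A = 1 \<Longrightarrow> N A0 \<le> N A"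
    using continuous_attains_inf[OF sphere cont] by (auto simp: dist_norm)
  obtain A1 where max: "\<And>A. norm A = 1 \<Longrightarrow> N A \<le> N A1"
    using continuous_attains_sup[OF sphere cont] by (auto simp: Ball_def)
  have "N A0 > 0"
    using A0 nonneg[of A0] zero[of A0] by (auto simp: less_le)
  have scale: "N A = norm A * N (A /\<^sub>R norm A)" for A
    by (cases "A = 0") (simp_all add: hom zero)
  have unit: "norm (A /\<^sub>R norm A) = 1" if "A \<noteq> 0" for A :: "complex ^ 'd ^ 'd"
    using that by simp
  show thesis
  proof (rule that[of "1 / N A0" "N A1"])
    show "1 / N A0 > 0" using \<open>N A0 > 0\<close> by simp
    show "N A1 > 0" using max[OF A0] \<open>N A0 > 0\<close> by simp
  next
    fix A
    show "norm A \<le> 1 / N A0 * N A"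
    proof (cases "A = 0")
      case False
      then have "norm A * N A0 \<le> N A"
        unfolding scale[of A] by (intro mult_left_mono min unit) auto
      then show ?thesis
        using \<open>N A0 > 0\<close> by (simp add: field_simps)
    qed (simp add: nonneg)
  next
    fix A
    show "N A \<le> N A1 * norm A"
    proof (cases "A = 0")
      case True
      then show ?thesis using zero[of A] by simp
    next
      case False
      then have "norm A * N (A /\<^sub>R norm A) \<le> norm A * N A1"
        by (intro mult_left_mono max unit) auto
      then show ?thesis
        using scale[of A] by (simp add: mult.commute)
    qed
  qed
qed

section \<open>Products of matrices close to the identity\<close>

lemma matrix_inv_cancel:
  assumes "invertible (A :: complex ^ 'd ^ 'd)"
  shows "A ** matrix_inv A = mat 1" "matrix_inv A ** A = mat 1"
proof -
  have "A ** matrix_inv A = mat 1 \<and> matrix_inv A ** A = mat 1"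
    unfolding matrix_inv_def by (rule someI_ex) (use assms in \<open>simp add: invertible_def\<close>)
  then show "A ** matrix_inv A = mat 1" "matrix_inv A ** A = mat 1"
    by auto
qed

text \<open>
  Multiplying the recursion from the left by the inverse of \<open>G m\<close> gives a sequence of the same
  kind started at the identity at time \<open>m\<close>. Its limit differs from the identity by
  at most a constant times a tail of a convergent series, so its determinant tends to \<open>1\<close>,
  which is impossible if \<open>det F = 0\<close>.
\<close>

lemma invertible_limit_of_products:
  fixes G E :: "nat \<Rightarrow> complex ^ 'd ^ 'd"
  assumes step: "\<And>n. G (Suc n) - G n = G n ** E n"
    and inv: "\<And>n. invertible (G n)"
    and summable: "summable (\<lambda>n. norm (E n))"
    and lim: "G \<longlonglongrightarrow> F"
  shows "invertible F"
proof -
  interpret mm: bounded_bilinear "(**) :: complex ^ 'd ^ 'd \<Rightarrow> complex ^ 'd ^ 'd \<Rightarrow> complex ^ 'd ^ 'd"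
    by (rule bounded_bilinear_complex_matrix_mult)
  obtain K where "K > 0"
    and K: "\<And>(A :: complex ^ 'd ^ 'd) (B :: complex ^ 'd ^ 'd). norm (A ** B) \<le> norm A * norm B * K"
    using complex_matrix_mult_bound by metis
  define \<delta> where "\<delta> n = norm (E n) * K" for n
  have \<delta>: "summable \<delta>" "\<And>n. 0 \<le> \<delta> n"
    using summable_mult2[OF summable, of K] \<open>K > 0\<close> by (simp_all add: \<delta>_def[abs_def])
  let ?I = "mat 1 :: complex ^ 'd ^ 'd"
  have tail: "norm (matrix_inv (G m) ** F - ?I)
      \<le> norm ?I * exp (\<Sum>i. \<delta> (i + m)) * (\<Sum>i. \<delta> (i + m))" for m
  proof -
    let ?X = "\<lambda>n. matrix_inv (G m) ** G (n + m)"
    have "?X (Suc n) - ?X n = ?X n ** E (n + m)" for n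
      using step[of "n + m"] by (simp add: mm.diff_right[symmetric] matrix_mul_assoc)
    then have "norm (?X (Suc n) - ?X n) \<le> norm (?X n) * \<delta> (n + m)" for n
      using K[of "?X n" "E (n + m)"] by (simp add: \<delta>_def mult.assoc)
    then obtain l where l: "?X \<longlonglongrightarrow> l"
      and rate: "\<And>k. norm (l - ?X k)
        \<le> norm (?X 0) * exp (\<Sum>i. \<delta> (i + m)) * (\<Sum>i. \<delta> (i + k + m))"
      using relative_increments_limit[of ?X "\<lambda>n. \<delta> (n + m)"] \<delta> by auto
    have "?X \<longlonglongrightarrow> matrix_inv (G m) ** F"
      by (intro mm.tendsto tendsto_const LIMSEQ_ignore_initial_segment lim)
    then have "l = matrix_inv (G m) ** F"
      using l LIMSEQ_unique by blast
    then show ?thesis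
      using rate[of 0] by (simp add: matrix_inv_cancel inv)
  qed
  have "(\<lambda>m. \<Sum>i. \<delta> (i + m)) \<longlonglongrightarrow> 0"
    by (rule suminf_exist_split2[OF \<delta>(1)])
  then have "(\<lambda>m. norm ?I * exp (\<Sum>i. \<delta> (i + m)) * (\<Sum>i. \<delta> (i + m))) \<longlonglongrightarrow> norm ?I * exp 0 * 0"
    by (intro tendsto_intros)
  then have "(\<lambda>m. matrix_inv (G m) ** F - ?I) \<longlonglongrightarrow> 0"
    by (intro Lim_null_comparison[OF always_eventually[OF allI[OF tail]]]) simp
  then have "(\<lambda>m. matrix_inv (G m) ** F) \<longlonglongrightarrow> ?I"
    by (simp only: LIM_zero_iff)
  then have "(\<lambda>m. det (matrix_inv (G m) ** F)) \<longlonglongrightarrow> det ?I"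
    by (rule tendsto_det)
  then have "(\<lambda>m. det (matrix_inv (G m)) * det F) \<longlonglongrightarrow> 1"
    by (simp only: det_mul det_I)
  then have "det F \<noteq> 0"
    using LIMSEQ_unique[OF tendsto_const, of 0 "1 :: complex"] by auto
  then show ?thesis
    by (simp add: invertible_det_nz)
qed

section \<open>Conjugates of the unitary group\<close>

text \<open>
  The diagonal entries of \<open>U U\<^sup>* = 1\<close> say that the rows of \<open>U\<close> are unit vectors.
\<close>

lemma bounded_unitary_group: "bounded (unitary_group :: (complex ^ 'd ^ 'd) set)"
proof -
  have "norm U \<le> sqrt (real (CARD('d)))" if U: "U \<in> unitary_group" for U :: "complex ^ 'd ^ 'd"
  proof -
    have "(norm (U $ i))\<^sup>2 = 1" for i
    proof -
      have "(U ** conj_transpose U) $ i $ i = 1"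
        using U by (simp add: unitary_group_def mat_def)
      then have "(\<Sum>k\<in>UNIV. of_real ((cmod (U $ i $ k))\<^sup>2)) = (1 :: complex)"
        by (simp add: matrix_matrix_mult_def conj_transpose_def complex_norm_square del: of_real_power)
      then have "(\<Sum>k\<in>UNIV. (cmod (U $ i $ k))\<^sup>2) = 1"
        by (simp only: of_real_sum[symmetric] of_real_eq_1_iff)
      then show ?thesis
        by (simp add: norm_vec_def L2_set_def)
    qed
    then show ?thesis
      by (simp add: norm_vec_def[of U] L2_set_def)
  qed
  then show ?thesis
    by (auto simp: bounded_iff)
qed

lemma bounded_conjugate_of_unitary_group:
  assumes "conjugate_in_GL H (unitary_group :: (complex ^ 'd ^ 'd) set)"
  shows "bounded H"
proof -
  interpret mm: bounded_bilinear "(**) :: complex ^ 'd ^ 'd \<Rightarrow> complex ^ 'd ^ 'd \<Rightarrow> complex ^ 'd ^ 'd"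
    by (rule bounded_bilinear_complex_matrix_mult)
  obtain S :: "complex ^ 'd ^ 'd" where S: "H = (\<lambda>U. S ** U ** matrix_inv S) ` unitary_group"
    using assms by (unfold conjugate_in_GL_def) blast
  have "bounded_linear (\<lambda>U. S ** U ** matrix_inv S)"
    by (rule bounded_linear_compose[OF mm.bounded_linear_left mm.bounded_linear_right])
  then show ?thesis
    unfolding S by (rule bounded_linear_image[OF bounded_unitary_group])
qed

text \<open>
  The closure of a subgroup under inverses concerns the abstract inverse of the monoid, defined by
  a description; uniqueness of two-sided inverses identifies it with \<^const>\<open>matrix_inv\<close>.
\<close>

lemma matrix_inv_mem_subgroup:
  assumes "subgroup H general_linear" "A \<in> H"
  shows "matrix_inv A \<in> H"
proof -
  have "invertible A"
    using subgroup.subset[OF assms(1)] assms(2) by (auto simp: general_linear_def)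
  note A = matrix_inv_cancel[OF this]
  have "inv\<^bsub>general_linear\<^esub> A = matrix_inv A"
    unfolding m_inv_def
  proof (rule the_equality, goal_cases)
    case 1
    have "invertible (matrix_inv A)"
      unfolding invertible_def using A by blast
    then show ?case
      using A by (simp add: general_linear_def)
  next
    case (2 B)
    then have "B ** A = mat 1"
      by (simp add: general_linear_def)
    have "B = B ** (A ** matrix_inv A)"
      by (simp only: A matrix_mul_rid)
    also have "\<dots> = matrix_inv A"
      by (simp only: matrix_mul_assoc \<open>B ** A = mat 1\<close> matrix_mul_lid)
    finally show ?case .
  qed
  then show ?thesis
    using subgroup.m_inv_closed[OF assms] by simp
qed

lemma mprod_mem_subgroup:
  assumes "subgroup H general_linear" "\<And>i. i \<ge> 1 \<Longrightarrow> A i \<in> H"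
  shows "mprod A n \<in> H"
proof (induction n)
  case 0
  show ?case
    using subgroup.one_closed[OF assms(1)] by (simp add: general_linear_def)
next
  case (Suc n)
  then show ?case
    using subgroup.m_closed[OF assms(1) Suc assms(2)[of "Suc n"]] by (simp add: general_linear_def)
qed

section \<open>Asymptotic sequences\<close>

lemma seq_closure_mono_asymp:
  fixes s t :: "nat \<Rightarrow> 'a::metric_space"
  assumes "asymp_seq dist s t"
  shows "seq_closure s \<subseteq> seq_closure t"
proof
  fix l assume "l \<in> seq_closure s"
  then obtain r where r: "strict_mono r" "(s \<circ> r) \<longlonglongrightarrow> l"
    by (auto simp: seq_closure_def)
  have "(\<lambda>n. dist (s (r n)) (t (r n))) \<longlonglongrightarrow> 0"
    using LIMSEQ_subseq_LIMSEQ[OF assms[unfolded asymp_seq_def] r(1)] by (simp add: o_def)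
  moreover have "(\<lambda>n. dist (s (r n)) l) \<longlonglongrightarrow> 0"
    using r(2) by (simp add: tendsto_dist_iff[of _ l] o_def)
  ultimately have "(\<lambda>n. dist (s (r n)) (t (r n)) + dist (s (r n)) l) \<longlonglongrightarrow> 0"
    using tendsto_add_zero by blast
  moreover have "norm (dist (t (r n)) l) \<le> dist (s (r n)) (t (r n)) + dist (s (r n)) l" for n
    using dist_triangle3[of "t (r n)" l "s (r n)"] by simp
  ultimately have "(\<lambda>n. dist (t (r n)) l) \<longlonglongrightarrow> 0"
    by (rule Lim_null_comparison[OF always_eventually[OF allI], rotated])
  then have "(t \<circ> r) \<longlonglongrightarrow> l"
    by (simp add: tendsto_dist_iff[of _ l] o_def)
  with r(1) show "l \<in> seq_closure t"
    by (auto simp: seq_closure_def)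
qed

lemma asymp_seq_sym:
  fixes s t :: "nat \<Rightarrow> 'a::metric_space"
  shows "asymp_seq dist s t \<Longrightarrow> asymp_seq dist t s"
  by (simp add: asymp_seq_def dist_commute)

lemma seq_closure_eq_asymp:
  fixes s t :: "nat \<Rightarrow> 'a::metric_space"
  assumes "asymp_seq dist s t"
  shows "seq_closure s = seq_closure t"
  using seq_closure_mono_asymp[OF assms] seq_closure_mono_asymp[OF asymp_seq_sym[OF assms]]
  by (rule antisym)

text \<open>
  Boundedness passes from \<open>t\<close> to \<open>s\<close>, so only closedness needs an argument: a limit point of
  the values of \<open>s\<close> is approached by \<open>s n\<close> with \<open>n\<close> arbitrarily large, where \<open>t n\<close> is close to
  \<open>s n\<close>, and so it lies in the closure of the values of \<open>t\<close>.
\<close>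

lemma compact_closure_union_asymp:
  fixes s t :: "nat \<Rightarrow> 'a::heine_borel"
  assumes asymp: "asymp_seq dist s t" and bdd: "bounded (range t)"
  shows "compact (closure (t ` {h..}) \<union> s ` {h..})"
proof -
  have lim: "(\<lambda>n. dist (s n) (t n)) \<longlonglongrightarrow> 0"
    using asymp by (simp add: asymp_seq_def)
  obtain c e where t: "\<And>n. dist c (t n) \<le> e"
    using bdd by (auto simp: bounded_def)
  obtain b where b: "\<And>n. dist (s n) (t n) \<le> b"
    using convergent_imp_Bseq[OF convergentI[OF lim]] by (auto simp: Bseq_def)
  have "dist c (s n) \<le> e + b" for n
    using dist_triangle[of c "s n" "t n"] t[of n] b[of n] by (simp add: dist_commute)
  then have "bounded (s ` {h..})"
    by (auto simp: bounded_def)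
  moreover have "bounded (closure (t ` {h..}))"
    using bdd by (auto intro: bounded_subset)
  moreover have "closed (closure (t ` {h..}) \<union> s ` {h..})"
    unfolding closed_limpt
  proof (intro allI impI)
    fix x assume "x islimpt closure (t ` {h..}) \<union> s ` {h..}"
    then consider "x islimpt closure (t ` {h..})" | "x islimpt s ` {h..}"
      by (auto simp: islimpt_Un)
    then show "x \<in> closure (t ` {h..}) \<union> s ` {h..}"
    proof cases
      case 1
      then show ?thesis
        using closed_limpt[of "closure (t ` {h..})"] by auto
    next
      case 2
      have "\<exists>y\<in>t ` {h..}. dist y x < e" if e: "e > 0" for e
      proof -
        obtain n0 where n0: "\<And>n. n \<ge> n0 \<Longrightarrow> dist (s n) (t n) < e / 2"
          using lim[unfolded lim_sequentially, rule_format, of "e / 2"] e by auto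
        \<comment> \<open>Infinitely many values of \<open>s\<close> are near \<open>x\<close>, and only finitely many of them occur before \<open>n0\<close>.\<close>
        have "infinite (s ` {h..} \<inter> ball x (e / 2))"
          using 2 e by (simp add: islimpt_eq_infinite_ball)
        then have "infinite (s ` {h..} \<inter> ball x (e / 2) - s ` {..<n0})"
          by simp
        then have "\<exists>y. y \<in> s ` {h..} \<inter> ball x (e / 2) - s ` {..<n0}"
          unfolding ex_in_conv by (rule infinite_imp_nonempty)
        then obtain y where y: "y \<in> s ` {h..} \<inter> ball x (e / 2) - s ` {..<n0}" ..
        from y have "y \<in> s ` {h..}" by (rule DiffE) (rule IntD1)
        then obtain n where n: "y = s n" "n \<ge> h"
          by (rule imageE) simp
        have "n \<ge> n0"
        proof (rule ccontr)
          assume "\<not> n \<ge> n0"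
          then have "y \<in> s ` {..<n0}"
            unfolding n(1) by (intro imageI) simp
          with y show False
            by (rule DiffD2)
        qed
        have "dist x (s n) < e / 2"
          using y by (simp add: n(1))
        have "dist (t n) x < e"
          using n0[OF \<open>n \<ge> n0\<close>] \<open>dist x (s n) < e / 2\<close> dist_triangle[of "t n" x "s n"]
          by (simp add: dist_commute)
        with n(2) show ?thesis by auto
      qed
      then show ?thesis
        by (auto simp: closure_approachable)
    qed
  qed
  ultimately show ?thesis
    by (simp add: compact_eq_bounded_closed)
qed

text \<open>
  Continuity alone does not preserve \<open>\<asymp>\<close>, since the two sequences need not converge;
  compactness supplies the uniform continuity that does.
\<close>

lemma asymp_seq_continuous_image:
  fixes f :: "'a::metric_space \<Rightarrow> 'b::metric_space"
  assumes cont: "continuous_on X f" and X: "compact X"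
    and mem: "\<And>n. n \<ge> h \<Longrightarrow> s n \<in> X \<and> t n \<in> X"
    and asymp: "asymp_seq dist s t"
  shows "asymp_seq dist (\<lambda>n. f (s n)) (\<lambda>n. f (t n))"
  unfolding asymp_seq_def lim_sequentially
proof (intro allI impI)
  fix e :: real assume "e > 0"
  obtain d where "d > 0" and d: "\<And>x y. x \<in> X \<Longrightarrow> y \<in> X \<Longrightarrow> dist x y < d \<Longrightarrow> dist (f x) (f y) < e"
    using compact_uniformly_continuous[OF cont X] \<open>e > 0\<close>
    unfolding uniformly_continuous_on_def by metis
  obtain n0 where "\<And>n. n \<ge> n0 \<Longrightarrow> dist (s n) (t n) < d"
    using asymp \<open>d > 0\<close> by (auto simp: asymp_seq_def lim_sequentially)
  then show "\<exists>n0. \<forall>n\<ge>n0. dist (dist (f (s n)) (f (t n))) 0 < e"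
    using d mem by (intro exI[of _ "max h n0"]) auto
qed

section \<open>Perturbed products\<close>

text \<open>
  Sums over sets of indices starting at \<open>1\<close> become series indexed from \<open>0\<close>, in which the term of
  index \<open>i\<close> belongs to the factor \<open>i + 1\<close>.
\<close>

lemma infsum_greaterThan_eq_suminf:
  fixes g :: "nat \<Rightarrow> real"
  assumes nonneg: "\<And>i. 0 \<le> g i" and sm: "g summable_on {1..}"
  shows "summable (\<lambda>i. g (Suc i))" "infsum g {n<..} = (\<Sum>i. g (Suc (i + n)))"
proof -
  have img: "{n<..} = range (\<lambda>i. Suc (i + n))" for n
  proof -
    have "m \<in> range (\<lambda>i. Suc (i + n))" if "m > n" for m
      using that by (intro image_eqI[of _ _ "m - Suc n"]) auto
    then show ?thesis by auto
  qed
  have inj: "inj (\<lambda>i. Suc (i + n))" for n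
    by (auto simp: inj_on_def)
  have "g summable_on {n<..}" for n
    by (rule summable_on_subset_banach[OF sm]) auto
  then have on: "(\<lambda>i. g (Suc (i + n))) summable_on UNIV" for n
    unfolding img summable_on_reindex[OF inj] by (simp add: o_def)
  show "summable (\<lambda>i. g (Suc i))"
    using on[of 0] by (intro summable_on_imp_summable) simp
  have "((\<lambda>i. g (Suc (i + n))) has_sum infsum g {n<..}) UNIV"
    using on[of n] unfolding img infsum_reindex[OF inj] by (simp add: o_def has_sum_infsum)
  then show "infsum g {n<..} = (\<Sum>i. g (Suc (i + n)))"
    using has_sum_imp_sums sums_unique by blast
qed

lemma invertible_mprod:
  assumes "\<And>i. i \<ge> 1 \<Longrightarrow> invertible (A i)"
  shows "invertible (mprod A n)"
proof (induction n)
  case 0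
  show ?case
    unfolding invertible_def by (intro exI[of _ "mat 1"]) simp
next
  case (Suc n)
  then show ?case
    using assms[of "Suc n"] by (simp add: invertible_mult)
qed

text \<open>
  The error at each step is put to the right of \<open>G n\<close>, flanked by bounded products of the
  \<open>M i\<close>, so that its size is relative to \<open>G n\<close> and proportional to \<open>D (Suc n) - M (Suc n)\<close>.
\<close>

lemma quotient_mprod_step:
  fixes M D :: "nat \<Rightarrow> complex ^ 'd ^ 'd"
  assumes "\<And>i. i \<ge> 1 \<Longrightarrow> invertible (M i)"
  defines "G \<equiv> \<lambda>n. mprod D n ** matrix_inv (mprod M n)"
  shows "G (Suc n) - G n
    = G n ** (mprod M n ** (D (Suc n) - M (Suc n)) ** matrix_inv (mprod M (Suc n)))"
proof -
  interpret mm: bounded_bilinear "(**) :: complex ^ 'd ^ 'd \<Rightarrow> complex ^ 'd ^ 'd \<Rightarrow> complex ^ 'd ^ 'd"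
    by (rule bounded_bilinear_complex_matrix_mult)
  let ?P = "mprod M n" and ?P' = "mprod M (Suc n)"
  note P = matrix_inv_cancel[OF invertible_mprod[OF assms(1)]]
  have "matrix_inv ?P = matrix_inv ?P ** (?P' ** matrix_inv ?P')"
    by (simp only: P matrix_mul_rid)
  also have "\<dots> = (matrix_inv ?P ** ?P) ** M (Suc n) ** matrix_inv ?P'"
    by (simp only: mprod.simps matrix_mul_assoc)
  \<comment> \<open>Cancelling the new factor: this is why the product with \<open>M\<close> in place of \<open>D\<close> leaves \<open>G n\<close> unchanged.\<close>
  finally have shift: "M (Suc n) ** matrix_inv ?P' = matrix_inv ?P"
    by (simp only: P matrix_mul_lid)
  have "G n ** (?P ** (D (Suc n) - M (Suc n)) ** matrix_inv ?P')
      = mprod D n ** (matrix_inv ?P ** ?P) ** (D (Suc n) - M (Suc n)) ** matrix_inv ?P'"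
    by (simp only: G_def matrix_mul_assoc)
  also have "\<dots> = mprod D n ** D (Suc n) ** matrix_inv ?P' - mprod D n ** (M (Suc n) ** matrix_inv ?P')"
    by (simp only: P matrix_mul_rid mm.diff_left mm.diff_right matrix_mul_assoc)
  finally show ?thesis
    by (simp only: shift) (simp add: G_def)
qed

theorem theorem3:
  fixes N :: "complex ^ 'd ^ 'd \<Rightarrow> real"
    and H :: "(complex ^ 'd ^ 'd) set"
    and M D :: "nat \<Rightarrow> complex ^ 'd ^ 'd"
    and \<epsilon> :: "nat \<Rightarrow> real"
  assumes "matrix_norm N"
    and "subgroup H general_linear"
    and "conjugate_in_GL H unitary_group"
    and "\<And>i. i \<ge> 1 \<Longrightarrow> M i \<in> H"
    and "\<And>i. i \<ge> 1 \<Longrightarrow> D i \<in> carrier general_linear"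
    and "(\<lambda>i. N (D i - M i)) summable_on {1..}"
    and "\<And>n. \<epsilon> n = (\<Sum>\<^sub>\<infinity>i\<in>{n<..}. N (D i - M i))"
  shows "\<exists>F.
    (\<lambda>n. mprod D n ** matrix_inv (mprod M n)) \<longlonglongrightarrow> F \<and>
    (invertible F \<longleftrightarrow> (\<forall>i\<ge>1. invertible (D i))) \<and>
    (\<lambda>n. N (F - mprod D n ** matrix_inv (mprod M n))) \<in> O(\<epsilon>) \<and>
    (\<lambda>n. N (mprod D n - F ** mprod M n)) \<in> O(\<epsilon>) \<and>
    asymp_seq (\<lambda>A B. N (A - B)) (mprod D) (\<lambda>n. F ** mprod M n) \<and>
    (\<forall>h\<ge>1. let X = closure {F ** mprod M n | n. n \<ge> h} \<union> (\<Union>n\<in>{h..}. {mprod D n}) in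
       compact X \<and>
       (\<forall>f :: complex ^ 'd ^ 'd \<Rightarrow> 'g::metric_space. continuous_on X f \<longrightarrow>
          asymp_seq dist (\<lambda>n. f (mprod D n)) (\<lambda>n. f (F ** mprod M n)) \<and>
          seq_closure (\<lambda>n. f (mprod D n)) = seq_closure (\<lambda>n. f (F ** mprod M n)))) \<and>
    seq_closure (mprod D) = seq_closure (\<lambda>n. F ** mprod M n)"
proof -
  interpret mm: bounded_bilinear "(**) :: complex ^ 'd ^ 'd \<Rightarrow> complex ^ 'd ^ 'd \<Rightarrow> complex ^ 'd ^ 'd"
    by (rule bounded_bilinear_complex_matrix_mult)
  obtain K where "K > 0"
    and K: "\<And>(A :: complex ^ 'd ^ 'd) (B :: complex ^ 'd ^ 'd). norm (A ** B) \<le> norm A * norm B * K"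
    using complex_matrix_mult_bound by metis
  obtain a b where "a > 0" "b > 0" and a: "\<And>A. norm A \<le> a * N A" and b: "\<And>A. N A \<le> b * norm A"
    by (rule matrix_norm_equivalent[OF assms(1)]) metis
  have N_nonneg: "0 \<le> N A" for A
    using assms(1) by (simp add: matrix_norm_def)
  define P where "P = mprod M"
  define G where "G n = mprod D n ** matrix_inv (P n)" for n
  define E where "E n = P n ** (D (Suc n) - M (Suc n)) ** matrix_inv (P (Suc n))" for n

  have invM: "invertible (M i)" if "i \<ge> 1" for i
    using subgroup.subset[OF assms(2)] assms(4)[OF that] by (auto simp: general_linear_def)
  have invD: "invertible (D i)" if "i \<ge> 1" for i
    using assms(5)[OF that] by (simp add: general_linear_def)
  have P_cancel: "P n ** matrix_inv (P n) = mat 1" "matrix_inv (P n) ** P n = mat 1" for n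
    using matrix_inv_cancel[OF invertible_mprod[OF invM]] by (auto simp: P_def)
  have P_mem: "P n \<in> H" "matrix_inv (P n) \<in> H" for n
    using mprod_mem_subgroup[OF assms(2,4)] matrix_inv_mem_subgroup[OF assms(2)]
    by (auto simp: P_def)
  obtain B where "B > 0" and B: "\<And>A. A \<in> H \<Longrightarrow> norm A \<le> B"
    using bounded_conjugate_of_unitary_group[OF assms(3)] by (auto simp: bounded_pos)

  let ?\<nu> = "\<lambda>i. N (D (Suc i) - M (Suc i))"
  have \<nu>: "summable ?\<nu>" and \<epsilon>: "\<epsilon> n = (\<Sum>i. ?\<nu> (i + n))" for n
    using infsum_greaterThan_eq_suminf[OF N_nonneg assms(6)] assms(7) by auto
  have \<nu>_tail: "summable (\<lambda>i. ?\<nu> (i + n))" for n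
    by (rule summable_ignore_initial_segment[OF \<nu>])
  have \<epsilon>_nonneg: "0 \<le> \<epsilon> n" for n
    unfolding \<epsilon> by (intro suminf_nonneg N_nonneg \<nu>_tail)
  have \<epsilon>_lim: "\<epsilon> \<longlonglongrightarrow> 0"
    using suminf_exist_split2[OF \<nu>] by (simp add: \<epsilon>[abs_def])

  \<comment> \<open>Two bounds \<open>B\<close> for the outer factors, two constants \<open>K\<close> for the two products, and \<open>a\<close> to pass
     from the Euclidean norm to \<open>N\<close>.\<close>
  define c where "c = B * a * K * B * K"
  have "c > 0"
    using \<open>a > 0\<close> \<open>B > 0\<close> \<open>K > 0\<close> by (simp add: c_def)
  have E_bound: "norm (E n) \<le> c * ?\<nu> n" for n
  proof -
    let ?A = "D (Suc n) - M (Suc n)"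
    have "norm (E n) \<le> norm (P n ** ?A) * norm (matrix_inv (P (Suc n))) * K"
      unfolding E_def by (rule K)
    also have "\<dots> \<le> (norm (P n) * norm ?A * K) * B * K"
      using \<open>K > 0\<close> by (intro mult_right_mono mult_mono K B P_mem) auto
    also have "\<dots> \<le> (B * (a * ?\<nu> n) * K) * B * K"
      using \<open>K > 0\<close> \<open>B > 0\<close> by (intro mult_right_mono mult_mono B P_mem a) auto
    finally show ?thesis
      by (simp add: c_def mult_ac)
  qed
  have G_step: "G (Suc n) - G n = G n ** E n" for n
    using quotient_mprod_step[OF invM, where D = D and n = n] by (simp add: G_def E_def P_def)
  have "norm (G (Suc n) - G n) \<le> norm (G n) * (K * c * ?\<nu> n)" for n
  proof -
    have "norm (G n ** E n) \<le> norm (G n) * norm (E n) * K"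
      by (rule K)
    also have "\<dots> \<le> norm (G n) * (c * ?\<nu> n) * K"
      using \<open>K > 0\<close> by (intro mult_right_mono mult_left_mono E_bound) auto
    finally show ?thesis
      by (simp add: G_step mult_ac)
  qed
  moreover have "0 \<le> K * c * ?\<nu> n" for n
    using \<open>K > 0\<close> \<open>c > 0\<close> N_nonneg by simp
  moreover have "summable (\<lambda>n. K * c * ?\<nu> n)"
    by (rule summable_mult[OF \<nu>])
  ultimately obtain F where F: "G \<longlonglongrightarrow> F"
    and rate: "\<And>m. norm (F - G m)
      \<le> norm (G 0) * exp (\<Sum>n. K * c * ?\<nu> n) * (\<Sum>i. K * c * ?\<nu> (i + m))"
    by (rule relative_increments_limit) blast
  define C where "C = norm (G 0) * exp (\<Sum>n. K * c * ?\<nu> n) * (K * c)"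
  have "C \<ge> 0"
    using \<open>K > 0\<close> \<open>c > 0\<close> by (simp add: C_def)
  have FG: "norm (F - G n) \<le> C * \<epsilon> n" for n
    using rate[of n] unfolding \<epsilon> C_def suminf_mult[OF \<nu>_tail] by (simp add: mult.assoc)
  have G_P: "G n ** P n = mprod D n" for n
    by (simp add: G_def matrix_mul_assoc[symmetric] P_cancel)
  have DF: "norm (mprod D n - F ** P n) \<le> C * B * K * \<epsilon> n" for n
  proof -
    have "norm (mprod D n - F ** P n) = norm ((F - G n) ** P n)"
      by (simp add: mm.diff_left G_P norm_minus_commute)
    also have "\<dots> \<le> norm (F - G n) * norm (P n) * K"
      by (rule K)
    also have "\<dots> \<le> (C * \<epsilon> n) * B * K"
      using \<open>K > 0\<close> \<open>C \<ge> 0\<close> \<epsilon>_nonneg[of n] by (intro mult_right_mono mult_mono FG B P_mem) auto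
    finally show ?thesis
      by (simp add: mult_ac)
  qed

  have invF: "invertible F"
  proof (rule invertible_limit_of_products[OF G_step _ _ F])
    show "summable (\<lambda>n. norm (E n))"
      by (rule summable_comparison_test'[OF summable_mult[OF \<nu>, of c], of 0]) (use E_bound in auto)
    have "invertible (matrix_inv (P n))" for n
      unfolding invertible_def using P_cancel by blast
    then show "invertible (G n)" for n
      unfolding G_def by (intro invertible_mult invertible_mprod invD)
  qed

  have bigo: "(\<lambda>n. N (X n)) \<in> O(\<epsilon>)" if "\<And>n. norm (X n) \<le> k * \<epsilon> n" for X and k
  proof (rule bigoI[of _ "b * k"], rule always_eventually, rule allI)
    fix n
    have "N (X n) \<le> b * norm (X n)" by (rule b)
    also have "\<dots> \<le> b * (k * \<epsilon> n)"
      using \<open>b > 0\<close> by (intro mult_left_mono that) auto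
    finally show "norm (N (X n)) \<le> b * k * norm (\<epsilon> n)"
      using N_nonneg[of "X n"] \<epsilon>_nonneg[of n] by (simp add: mult_ac)
  qed
  have diff_lim: "(\<lambda>n. norm (mprod D n - F ** P n)) \<longlonglongrightarrow> 0"
  proof (rule Lim_null_comparison[OF always_eventually])
    show "\<forall>n. norm (norm (mprod D n - F ** P n)) \<le> C * B * K * \<epsilon> n"
      using DF by simp
    show "(\<lambda>n. C * B * K * \<epsilon> n) \<longlonglongrightarrow> 0"
      using tendsto_mult_right_zero[OF \<epsilon>_lim] by simp
  qed
  have asymp: "asymp_seq dist (mprod D) (\<lambda>n. F ** P n)"
    using diff_lim by (simp add: asymp_seq_def dist_norm)
  have asympN: "asymp_seq (\<lambda>A B. N (A - B)) (mprod D) (\<lambda>n. F ** P n)"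
    unfolding asymp_seq_def
  proof (rule Lim_null_comparison[OF always_eventually])
    show "\<forall>n. norm (N (mprod D n - F ** P n)) \<le> b * norm (mprod D n - F ** P n)"
      using b N_nonneg by simp
    show "(\<lambda>n. b * norm (mprod D n - F ** P n)) \<longlonglongrightarrow> 0"
      using tendsto_mult_right_zero[OF diff_lim] by simp
  qed
  have bdd: "bounded (range (\<lambda>n. F ** P n))"
  proof -
    have "bounded ((\<lambda>A. F ** A) ` H)"
      by (intro bounded_linear_image[OF _ mm.bounded_linear_right]
          bounded_conjugate_of_unitary_group[OF assms(3)])
    then show ?thesis
      by (rule bounded_subset) (use P_mem in auto)
  qed
  have X: "compact X \<and>
       (\<forall>f :: complex ^ 'd ^ 'd \<Rightarrow> 'g. continuous_on X f \<longrightarrow>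
          asymp_seq dist (\<lambda>n. f (mprod D n)) (\<lambda>n. f (F ** P n)) \<and>
          seq_closure (\<lambda>n. f (mprod D n)) = seq_closure (\<lambda>n. f (F ** P n)))"
    if X_def: "X = closure {F ** P n | n. n \<ge> h} \<union> (\<Union>n\<in>{h..}. {mprod D n})" for X h
  proof -
    have X_eq: "X = closure ((\<lambda>n. F ** P n) ` {h..}) \<union> mprod D ` {h..}"
    proof -
      have "{F ** P n | n. n \<ge> h} = (\<lambda>n. F ** P n) ` {h..}"
        by auto
      then show ?thesis
        by (simp only: X_def UNION_singleton_eq_range)
    qed
    have cpt: "compact X"
      unfolding X_eq by (rule compact_closure_union_asymp[OF asymp bdd])
    have mem: "mprod D n \<in> X \<and> F ** P n \<in> X" if "n \<ge> h" for n
      using that closure_subset[of "(\<lambda>n. F ** P n) ` {h..}"] by (auto simp: X_eq)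
    have img: "asymp_seq dist (\<lambda>n. f (mprod D n)) (\<lambda>n. f (F ** P n))"
      if "continuous_on X f" for f :: "complex ^ 'd ^ 'd \<Rightarrow> 'g"
      using that cpt mem asymp by (rule asymp_seq_continuous_image)
    show ?thesis
      using cpt img seq_closure_eq_asymp[OF img] by blast
  qed
  show ?thesis
    unfolding Let_def P_def[symmetric] G_def[symmetric]
    using F invF invD bigo[OF FG] bigo[OF DF] asympN X[OF refl] seq_closure_eq_asymp[OF asymp]
    by (intro exI[of _ F] conjI) (auto simp: G_def[abs_def])
qed

end
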